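(* Let $d,k\in\mathbb{N}$. For every $r\ge0$ there exists $C_{r,d,k}\in(0,\infty)$ such that for every $d$-admissible $n$, if $X$ is a $(d,k,n)$-random Steiner complex and $\sigma\in X^{d-1}$ (a fixed $d$-element subset of $[n]$), then \[ \mathbb{P}\big(X(\sigma,r)\cong T_{d,k}(r)\big)\ge1-\frac{C_{r,d,k}}{n}. \]
   Context: $d$-admissible: $n\ge d+1$ with $d-j\mid\binom{n-j-1}{d-j-1}$ for all $0\le j\le d-1$. $(n,d)$-Steiner system: family of $(d+1)$-subsets of $[n]$ containing every $d$-subset exactly once. $(d,k,n)$-random Steiner complex: the complex on $[n]$ consisting of all subsets of size $\le d$ together with $S_1\cup\dots\cup S_k$, with $S_j$ i.i.d. uniformly random $(n,d)$-Steiner systems. For a $d$-complex $X$, $G_d(X)$ is the graph on the $(d-1)$-faces with $\sigma\ne\sigma'$ adjacent iff $\sigma\cup\sigma'$ is a $d$-face. The $r$-neighbouring complex $X(\sigma_0,r)$ is the subcomplex $Y$ with $Y^{d-1}$ the ball of radius $r$ about $\sigma_0$ in $G_d(X)$, $Y^d$ the $d$-faces of $X$ all of whose $(d-1)$-faces lie in $Y^{d-1}$, and, for $\ell<d-1$, $Y^\ell$ the $\ell$-faces of $X$ contained in some element of $Y^{d-1}$. The arboreal complex $T_{d,k}$: start with one $d$-face, attach to each of its $(d-1)$-faces $k-1$ new $d$-faces each with a new vertex, and inductively attach $k-1$ new $d$-faces (each with a new vertex) to each newly created $(d-1)$-face; $T_{d,k}(r)$ denotes $T_{d,k}(\sigma,r)$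 for any $(d-1)$-face $\sigma$ (all isomorphic by transitivity). $\cong$ is simplicial isomorphism. *)

theory Defs
  imports "HOL-Probability.Probability" "HOL-Library.FSet"
begin

text \<open>
  A simplicial complex is represented by its set of faces, the empty face (of dimension
  \<open>-1\<close>) included. Dimensions are integers so that \<open>d - 1\<close> and \<open>-1\<close> are meaningful.
\<close>

definition faces :: "int \<Rightarrow> 'a set set \<Rightarrow> 'a set set" where
  "faces l X = {\<sigma> \<in> X. finite \<sigma> \<and> int (card \<sigma>) = l + 1}"

definition simplicial_iso :: "'a set set \<Rightarrow> 'b set set \<Rightarrow> bool" where
  "simplicial_iso X Y \<longleftrightarrow> (\<exists>f. bij_betw f (\<Union>X) (\<Union>Y) \<and> (\<lambda>\<sigma>. f ` \<sigma>) ` X = Y)"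


subsection \<open>Neighbouring complexes\<close>

definition face_graph :: "nat \<Rightarrow> 'a set set \<Rightarrow> ('a set \<times> 'a set) set" where
  "face_graph d X = {(\<sigma>, \<sigma>'). \<sigma> \<in> faces (int d - 1) X \<and> \<sigma>' \<in> faces (int d - 1) X \<and>
     \<sigma> \<noteq> \<sigma>' \<and> \<sigma> \<union> \<sigma>' \<in> faces (int d) X}"

definition face_ball :: "nat \<Rightarrow> 'a set set \<Rightarrow> 'a set \<Rightarrow> nat \<Rightarrow> 'a set set" where
  "face_ball d X \<sigma>\<^sub>0 r =
     {\<sigma> \<in> faces (int d - 1) X. \<exists>m\<le>r. (\<sigma>\<^sub>0, \<sigma>) \<in> face_graph d X ^^ m}"

definition neighbouring_complex :: "nat \<Rightarrow> 'a set set \<Rightarrow> 'a set \<Rightarrow> nat \<Rightarrow> 'a set set" where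
  "neighbouring_complex d X \<sigma>\<^sub>0 r =
     face_ball d X \<sigma>\<^sub>0 r \<union>
     {\<tau> \<in> faces (int d) X. \<forall>\<rho> \<in> faces (int d - 1) X. \<rho> \<subseteq> \<tau> \<longrightarrow> \<rho> \<in> face_ball d X \<sigma>\<^sub>0 r} \<union>
     (\<Union>l\<in>{l. l < int d - 1}. {\<rho> \<in> faces l X. \<exists>\<sigma> \<in> face_ball d X \<sigma>\<^sub>0 r. \<rho> \<subseteq> \<sigma>})"


subsection \<open>Random Steiner complexes\<close>

definition admissible :: "nat \<Rightarrow> nat \<Rightarrow> bool" where
  "admissible d n \<longleftrightarrow> d + 1 \<le> n \<and> (\<forall>j<d. (d - j) dvd ((n - j - 1) choose (d - j - 1)))"

definition steiner_systems :: "nat \<Rightarrow> nat \<Rightarrow> nat set set set" where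
  "steiner_systems n d =
     {S. (\<forall>A\<in>S. A \<subseteq> {1..n} \<and> card A = d + 1) \<and>
         (\<forall>B. B \<subseteq> {1..n} \<and> card B = d \<longrightarrow> (\<exists>!A. A \<in> S \<and> B \<subseteq> A))}"

definition steiner_complex :: "nat \<Rightarrow> nat \<Rightarrow> nat \<Rightarrow> (nat \<Rightarrow> nat set set) \<Rightarrow> nat set set" where
  "steiner_complex d k n S = {\<sigma>. \<sigma> \<subseteq> {1..n} \<and> card \<sigma> \<le> d} \<union> (\<Union>j<k. S j)"

text \<open>
  The law of the random complex. It is meaningful only if \<open>steiner_systems n d\<close> is nonempty,
  since there is no uniform distribution on the empty set; admissibility alone does not
  guarantee this (for example, \<open>5\<close> is \<open>2\<close>-admissible).
\<close>

definition random_steiner_complex :: "nat \<Rightarrow> nat \<Rightarrow> nat \<Rightarrow> nat set set pmf" where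
  "random_steiner_complex d k n =
     map_pmf (steiner_complex d k n)
       (Pi_pmf {..<k} {} (\<lambda>_. pmf_of_set (steiner_systems n d)))"


subsection \<open>The arboreal complex\<close>

text \<open>
  The vertices of the initial \<open>d\<close>-face are \<open>Root 0, \<dots>, Root d\<close>; the new vertex of the
  \<open>j\<close>-th \<open>d\<close>-face attached to a \<open>(d-1)\<close>-face \<open>\<tau>\<close> is \<open>New \<tau> j\<close>.
\<close>

datatype arb_vertex = Root nat | New "arb_vertex fset" nat

text \<open>
  The attached \<open>d\<close>-faces depend only on \<open>\<tau>\<close> and \<open>j\<close>, not on the \<open>d\<close>-face \<open>F\<close> through which
  \<open>\<tau>\<close> is reached, so every \<open>(d-1)\<close>-face receives exactly \<open>k - 1\<close> new \<open>d\<close>-faces, once.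
\<close>

inductive_set arboreal_cells :: "nat \<Rightarrow> nat \<Rightarrow> arb_vertex fset set" for d k :: nat where
  init: "Root |`| fset_of_list [0..<d + 1] \<in> arboreal_cells d k"
| attach: "F \<in> arboreal_cells d k \<Longrightarrow> \<tau> |\<subseteq>| F \<Longrightarrow> fcard \<tau> = d \<Longrightarrow> j < k - 1 \<Longrightarrow>
    finsert (New \<tau> j) \<tau> \<in> arboreal_cells d k"

definition arboreal_complex :: "nat \<Rightarrow> nat \<Rightarrow> arb_vertex set set" where
  "arboreal_complex d k = {\<sigma>. \<exists>F \<in> arboreal_cells d k. \<sigma> \<subseteq> fset F}"

text \<open>
  All \<open>(d-1)\<close>-faces of the arboreal complex are equivalent under automorphisms; the base face
  chosen here is a facet of the initial \<open>d\<close>-face.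
\<close>

definition arboreal_ball :: "nat \<Rightarrow> nat \<Rightarrow> nat \<Rightarrow> arb_vertex set set" where
  "arboreal_ball d k r = neighbouring_complex d (arboreal_complex d k) (Root ` {..<d}) r"

end

theory Submission imports Defs begin

text \<open>
  Colour the \<open>d\<close>-faces of the arboreal complex with the \<open>k\<close> indices of the Steiner systems so that
  the \<open>k\<close> cells around each \<open>(d-1)\<close>-face get different colours. Given systems \<open>S\<close> there is then a unique
  map \<open>\<phi> S\<close> from the arboreal vertices to \<open>[n]\<close> which extends the identification of the base face with
  \<open>\<sigma>\<close> and sends each cell of colour \<open>c\<close> into \<open>S c\<close>. If it is injective up to depth \<open>r + 1\<close>, it restricts to
  an isomorphism of \<open>T(r)\<close> onto the neighbourhood of \<open>\<sigma>\<close>.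

  Suppose that the first collision \<open>\<phi> x = \<phi> z\<close> occurs at depth \<open>D + 1\<close>, with \<open>x\<close> attached to \<open>\<tau>\<close>
  by a cell of colour \<open>c\<close>. The deepest vertex \<open>y\<close> of \<open>\<tau>\<close> lies in no other explored cell of colour \<open>c\<close>, so
  exchanging \<open>u = \<phi> y\<close> with an unused point \<open>b\<close> in \<open>S c\<close> only leaves \<open>\<phi>\<close> unchanged on the explored
  vertices. The new systems determine \<open>b\<close>, as the point completing the image of \<open>\<tau> - y\<close>
  together with \<open>\<phi> z\<close> to a block. So each \<open>S\<close> with this collision yields \<open>n - O(1)\<close>
  systems, no system arises twice, and the collision has probability \<open>O(1/n)\<close>.
\<close>

subsection \<open>Colouring the arboreal complex\<close>

text \<open>For \<open>c < k\<close> this is a bijection from \<open>{..<k - 1}\<close> onto the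
  colours below \<open>k\<close> other than \<open>c\<close>: the \<open>k - 1\<close> cells
  attached to a face take the colours that the cell already present leaves free.\<close>

definition skip :: "nat \<Rightarrow> nat \<Rightarrow> nat" where
  "skip c j = (if j < c then j else Suc j)"

text \<open>The choice is made among pairs, not among vertices, because the primitive recursion for
  \<open>depth_colour\<close> sees a face only through the set of its recursive values.\<close>

definition deepest :: "(nat \<times> nat) fset \<Rightarrow> nat \<times> nat" where
  "deepest P = (SOME p. p |\<in>| P \<and> (\<forall>q. q |\<in>| P \<longrightarrow> fst q \<le> fst p))"

text \<open>
  Pairs of depth and colour. Among the vertices of a \<open>(d-1)\<close>-face the deepest one is unique, except in
  the base face, where all pairs are \<open>(0, 0)\<close>; so \<open>deepest\<close> never makes an arbitrary choice there.
\<close>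

primrec depth_colour :: "nat \<Rightarrow> arb_vertex \<Rightarrow> nat \<times> nat" where
  "depth_colour d (Root i) = (if i < d then 0 else 1, 0)"
| "depth_colour d (New \<tau> j) =
     (let p = deepest (depth_colour d |`| \<tau>) in (Suc (fst p), skip (snd p) j))"

lemma skip_less: "c < k \<Longrightarrow> j < k - 1 \<Longrightarrow> skip c j < k"
  by (auto simp: skip_def)

lemma skip_neq: "skip c j \<noteq> c"
  by (auto simp: skip_def)

lemma skip_inj: "skip c j = skip c j' \<Longrightarrow> j = j'"
  by (auto simp: skip_def split: if_splits)

lemma skip_surj:
  assumes "c < k" "c' < k" "c' \<noteq> c"
  shows "\<exists>j<k - 1. skip c j = c'"
proof (cases "c' < c")
  case True
  then show ?thesis using assms by (intro exI[of _ c']) (auto simp: skip_def)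
next
  case False
  then show ?thesis using assms by (intro exI[of _ "c' - 1"]) (auto simp: skip_def)
qed

text \<open>A finite nonempty face has a vertex of maximal depth, so the choice in
  \<open>deepest\<close> is realised, and the chosen pair can be pulled back to a vertex.\<close>

lemma deepest_fimage:
  assumes "\<tau> \<noteq> {||}"
  obtains y where "y \<in> fset \<tau>" "deepest (f |`| \<tau>) = f y" "\<And>z. z \<in> fset \<tau> \<Longrightarrow> fst (f z) \<le> fst (f y)"
proof -
  let ?Q = "\<lambda>p. p |\<in>| f |`| \<tau> \<and> (\<forall>q. q |\<in>| f |`| \<tau> \<longrightarrow> fst q \<le> fst p)"
  have fin: "finite ((\<lambda>z. fst (f z)) ` fset \<tau>)" and ne: "(\<lambda>z. fst (f z)) ` fset \<tau> \<noteq> {}"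
    using assms by (auto simp: bot_fset.rep_eq fset_inject[symmetric])
  from Max_in[OF fin ne] obtain y0 where "y0 \<in> fset \<tau>"
    and y0: "fst (f y0) = Max ((\<lambda>z. fst (f z)) ` fset \<tau>)" by auto
  moreover have "fst (f z) \<le> fst (f y0)" if "z \<in> fset \<tau>" for z
    unfolding y0 using fin that by (intro Max_ge) auto
  ultimately have "?Q (f y0)" by (metis fimageE fimageI)
  then have *: "?Q (deepest (f |`| \<tau>))"
    unfolding deepest_def by (rule someI)
  then obtain y where "y \<in> fset \<tau>" "deepest (f |`| \<tau>) = f y" by auto
  with * show thesis by (intro that[of y]) (auto simp del: split_paired_All)
qed

section \<open>Cells of the arboreal complex indexed by their newest vertex\<close>

locale arboreal =
  fixes d k :: nat
  assumes d_pos: "d \<ge> 1" and k_pos: "k \<ge> 1"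
begin

definition depth :: "arb_vertex \<Rightarrow> nat" where "depth x = fst (depth_colour d x)"

definition colour :: "arb_vertex \<Rightarrow> nat" where "colour x = snd (depth_colour d x)"

definition base :: "arb_vertex set" where "base = Root ` {..<d}"

text \<open>The initial cell is read as one more attachment, of \<open>Root d\<close> to the base
  face, so that every cell has the form \<open>cell x\<close> for a single vertex
  \<open>x\<close>.\<close>

fun par :: "arb_vertex \<Rightarrow> arb_vertex set" where
  "par (Root i) = base"
| "par (New \<tau> j) = fset \<tau>"

definition cell :: "arb_vertex \<Rightarrow> arb_vertex set" where "cell x = insert x (par x)"

definition is_new :: "arb_vertex \<Rightarrow> bool" where
  "is_new x \<longleftrightarrow> x = Root d \<or>
     (\<exists>\<tau> j. x = New \<tau> j \<and> j < k - 1 \<and> fcard \<tau> = d \<and> (\<exists>F\<in>arboreal_cells d k. \<tau> |\<subseteq>| F))"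

definition facet :: "arb_vertex set \<Rightarrow> bool" where
  "facet t \<longleftrightarrow> card t = d \<and> (\<exists>x. is_new x \<and> t \<subseteq> cell x)"

lemma is_newE:
  assumes "is_new x"
  obtains "x = Root d" | \<tau> j F where "x = New \<tau> j" "j < k - 1" "card (fset \<tau>) = d"
    "F \<in> arboreal_cells d k" "fset \<tau> \<subseteq> fset F"
  using assms unfolding is_new_def fcard.rep_eq less_eq_fset.rep_eq by blast

lemma is_new_Root: "is_new (Root d)"
  by (simp add: is_new_def)

lemma cell_Root: "fset (Root |`| fset_of_list [0..<d + 1]) = cell (Root d)"
  by (auto simp: cell_def base_def fset_of_list.rep_eq)

lemma finite_par [simp]: "finite (par x)"
  by (cases x) (auto simp: base_def)

lemma finite_cell [simp]: "finite (cell x)"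
  by (simp add: cell_def)

lemma card_base [simp]: "card base = d"
  by (simp add: base_def card_image inj_on_def)

lemma arboreal_cells_imp_new:
  assumes "F \<in> arboreal_cells d k"
  shows "\<exists>x. is_new x \<and> fset F = cell x"
  using assms
proof cases
  case init
  then show ?thesis using is_new_Root cell_Root by metis
next
  case (attach F' \<tau> j)
  then have "is_new (New \<tau> j)" by (auto simp: is_new_def)
  moreover have "fset F = cell (New \<tau> j)" unfolding attach(1) by (simp add: cell_def)
  ultimately show ?thesis by blast
qed

lemma new_imp_arboreal_cells:
  assumes "is_new x"
  shows "\<exists>F\<in>arboreal_cells d k. fset F = cell x"
proof (cases "x = Root d")
  case True
  then show ?thesis using arboreal_cells.init cell_Root by metis
next
  case False
  then obtain \<tau> j F where *: "x = New \<tau> j" "j < k - 1" "fcard \<tau> = d"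
    "F \<in> arboreal_cells d k" "\<tau> |\<subseteq>| F"
    using assms by (auto simp: is_new_def)
  then have "finsert (New \<tau> j) \<tau> \<in> arboreal_cells d k"
    by (intro arboreal_cells.attach)
  then show ?thesis using * by (intro bexI) (auto simp: cell_def)
qed

lemma arboreal_complex_iff: "s \<in> arboreal_complex d k \<longleftrightarrow> (\<exists>x. is_new x \<and> s \<subseteq> cell x)"
proof
  assume "s \<in> arboreal_complex d k"
  then obtain F where "F \<in> arboreal_cells d k" "s \<subseteq> fset F" by (auto simp: arboreal_complex_def)
  then show "\<exists>x. is_new x \<and> s \<subseteq> cell x" using arboreal_cells_imp_new[of F] by auto
next
  assume "\<exists>x. is_new x \<and> s \<subseteq> cell x"
  then obtain x where "is_new x" "s \<subseteq> cell x" by blast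
  then show "s \<in> arboreal_complex d k"
    using new_imp_arboreal_cells[of x] by (auto simp: arboreal_complex_def)
qed

lemma card_par: "is_new x \<Longrightarrow> card (par x) = d"
  by (erule is_newE) simp_all

lemma facet_par: "is_new x \<Longrightarrow> facet (par x)"
  using card_par unfolding facet_def cell_def by blast

lemma facet_finite: "facet t \<Longrightarrow> finite t"
  using d_pos card.infinite by (fastforce simp: facet_def)

lemma facet_nonempty: "facet t \<Longrightarrow> t \<noteq> {}"
  using d_pos by (auto simp: facet_def)

lemma facet_base: "facet base"
  using facet_par[OF is_new_Root] by simp

text \<open>Induction on the construction. A \<open>d\<close>-subset of an attached cell either
  contains the new vertex, or by cardinality is the whole face attached to and so lies in the
  earlier cell.\<close>

lemma subset_arboreal_cell_cases:
  assumes "F \<in> arboreal_cells d k" "t \<subseteq> fset F" "card t = d"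
  shows "t = base \<or> (\<exists>y. is_new y \<and> y \<in> t \<and> t \<subseteq> cell y)"
  using assms
proof (induction arbitrary: t)
  case init
  then have t: "t \<subseteq> cell (Root d)" by (simp only: cell_Root)
  show ?case
  proof (cases "Root d \<in> t")
    case True
    then show ?thesis using t is_new_Root by blast
  next
    case False
    then have "t \<subseteq> base" using t by (auto simp: cell_def)
    then have "t = base" using init by (intro card_subset_eq) (auto simp: base_def card_image inj_on_def)
    then show ?thesis ..
  qed
next
  case (attach F \<tau> j)
  have new: "is_new (New \<tau> j)" using attach by (auto simp: is_new_def)
  show ?case
  proof (cases "New \<tau> j \<in> t")
    case True
    then show ?thesis using attach new by (intro disjI2 exI[of _ "New \<tau> j"]) (auto simp: cell_def)
  next
    case False
    then have "t \<subseteq> fset \<tau>" using attach by auto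
    moreover have "card (fset \<tau>) = d" using attach by (simp add: fcard.rep_eq)
    ultimately have "t = fset \<tau>" using attach by (intro card_subset_eq) auto
    then show ?thesis using attach by (intro attach.IH) (auto simp: less_eq_fset.rep_eq)
  qed
qed

lemma facet_cases:
  assumes "facet t"
  obtains "t = base" | y where "is_new y" "y \<in> t" "t \<subseteq> cell y"
proof -
  obtain x where x: "is_new x" "t \<subseteq> cell x" "card t = d" using assms by (auto simp: facet_def)
  obtain F where "F \<in> arboreal_cells d k" "fset F = cell x"
    using new_imp_arboreal_cells[OF x(1)] by blast
  then show thesis using subset_arboreal_cell_cases[of F t] x that by auto
qed

section \<open>Depth and colour of new vertices\<close>

lemma deepest_par:
  assumes "is_new x"
  shows "\<exists>y\<in>par x. depth x = Suc (depth y) \<and> (\<forall>z\<in>par x. depth z \<le> depth y) \<and>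
    (\<forall>\<tau> j. x = New \<tau> j \<longrightarrow> colour x = skip (colour y) j)"
proof (cases x)
  case (Root i)
  \<comment> \<open>\<open>Root d\<close> keeps colour 0, that of the base vertices, instead of
    skipping it; hence the restriction to \<open>New\<close> in the colour clause.\<close>
  then have i: "i = d" using assms by (auto simp: is_new_def)
  show ?thesis
    by (rule bexI[of _ "Root 0"]) (use Root i d_pos in \<open>auto simp: depth_def base_def\<close>)
next
  case (New \<tau> j)
  then have "\<tau> \<noteq> {||}" using assms d_pos by (auto simp: is_new_def fcard.rep_eq)
  from deepest_fimage[OF this, of "depth_colour d"] obtain y where y: "y \<in> fset \<tau>"
    "deepest (depth_colour d |`| \<tau>) = depth_colour d y"
    "\<And>z. z \<in> fset \<tau> \<Longrightarrow> fst (depth_colour d z) \<le> fst (depth_colour d y)" by blast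
  show ?thesis
    by (rule bexI[of _ y]) (use New y in \<open>auto simp: depth_def colour_def Let_def\<close>)
qed

lemma depth_par:
  assumes "is_new x" "z \<in> par x"
  shows "depth z < depth x"
proof -
  obtain y where "depth x = Suc (depth y)" "\<And>z. z \<in> par x \<Longrightarrow> depth z \<le> depth y"
    using deepest_par[OF assms(1)] by blast
  then show ?thesis using assms(2) by (simp add: le_imp_less_Suc)
qed

lemma notin_par: "is_new x \<Longrightarrow> x \<notin> par x"
  using depth_par by blast

lemma card_cell: "is_new x \<Longrightarrow> card (cell x) = d + 1"
  using notin_par card_par by (simp add: cell_def)

lemma depth_base: "z \<in> base \<Longrightarrow> depth z = 0"
  by (auto simp: base_def depth_def)

lemma colour_base: "z \<in> base \<Longrightarrow> colour z = 0"
  by (auto simp: base_def colour_def)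

lemma depth_new:
  assumes "is_new x"
  shows "depth x > 0"
  using deepest_par[OF assms] by auto

lemma not_new_base: "z \<in> base \<Longrightarrow> \<not> is_new z"
  using depth_base depth_new by fastforce

lemma cell_vertex_cases:
  assumes "is_new x" "z \<in> cell x"
  shows "z \<in> base \<or> is_new z"
proof -
  have "z \<in> base \<or> is_new z" if "F \<in> arboreal_cells d k" "z \<in> fset F" for F
    using that
  proof induction
    case init
    then show ?case by (auto simp: base_def is_new_def fset_of_list.rep_eq less_Suc_eq)
  next
    case (attach F \<tau> j)
    then show ?case by (auto simp: is_new_def)
  qed
  then show ?thesis using assms new_imp_arboreal_cells by blast
qed

text \<open>By \<open>facet_cases\<close> a parent face other than the base contains the newest
  vertex of a cell around it. All other vertices of that cell are strictly shallower, so this vertex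
  is the deepest one.\<close>

lemma deepest_par_new:
  assumes "is_new x" "y \<in> par x" "\<And>z. z \<in> par x \<Longrightarrow> depth z \<le> depth y"
  shows "par x = base \<and> y \<in> base \<or> is_new y \<and> par x \<subseteq> cell y"
  using facet_par[OF assms(1)]
proof (cases rule: facet_cases)
  case 1
  then show ?thesis using assms by simp
next
  case (2 y')
  have "y' = y"
  proof (rule ccontr)
    assume "y' \<noteq> y"
    then have "y \<in> par y'" using 2 assms by (auto simp: cell_def)
    then have "depth y < depth y'" using depth_par 2 by blast
    then show False using assms(3)[OF 2(2)] by simp
  qed
  then show ?thesis using 2 by simp
qed

lemma colour_less: "is_new x \<Longrightarrow> colour x < k"
proof (induction "depth x" arbitrary: x rule: less_induct)
  case less
  obtain y where y: "y \<in> par x" "depth x = Suc (depth y)" "\<And>z. z \<in> par x \<Longrightarrow> depth z \<le> depth y"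
    "\<And>\<tau> j. x = New \<tau> j \<Longrightarrow> colour x = skip (colour y) j"
    using deepest_par[OF less.prems] by blast
  have "colour y < k"
    using deepest_par_new[OF less.prems y(1) y(3)] less.hyps[of y] y(2) colour_base[of y] k_pos by auto
  then show ?case
    using less.prems y(4) skip_less k_pos by (auto simp: is_new_def colour_def)
qed

text \<open>The cell of \<open>y\<close> is the one through which \<open>par x\<close> arose, and
  its colour is the one that \<open>skip\<close> leaves out.\<close>

lemma colour_deepest_neq:
  assumes "is_new x" "is_new y" "y \<in> par x" "par x \<subseteq> cell y"
  shows "colour x \<noteq> colour y"
proof -
  obtain y' where y': "y' \<in> par x" "\<And>z. z \<in> par x \<Longrightarrow> depth z \<le> depth y'"
    "\<And>\<tau> j. x = New \<tau> j \<Longrightarrow> colour x = skip (colour y') j"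
    using deepest_par[OF assms(1)] by blast
  have "y' = y"
    using y'(1) y'(2)[OF assms(3)] assms(4) depth_par[OF assms(2)] by (force simp: cell_def)
  moreover have "x \<noteq> Root d" using assms not_new_base by auto
  ultimately show ?thesis using y'(3) skip_neq by (cases rule: is_newE[OF assms(1)]) auto
qed

text \<open>Cells attached to one face are told apart by their colours, because \<open>skip\<close>
  is injective in its second argument.\<close>

lemma new_eqI:
  assumes "is_new x" "is_new x'" "par x = par x'" "colour x = colour x'"
  shows "x = x'"
proof -
  \<comment> \<open>Over the base face the attached cells have positive colours, which separates
    them from \<open>Root d\<close> of colour 0.\<close>
  have base: "colour (New \<tau> j) = Suc j" if new: "is_new (New \<tau> j)" and eq: "fset \<tau> = base" for \<tau> j
  proof -
    obtain y where "y \<in> fset \<tau>" "colour (New \<tau> j) = skip (colour y) j"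
      using deepest_par[OF new] unfolding par.simps by blast
    then show ?thesis using eq colour_base by (simp add: skip_def)
  qed
  show ?thesis
  proof (cases x; cases x')
    fix \<tau> \<tau>' j j' assume x: "x = New \<tau> j" "x' = New \<tau>' j'"
    then have [simp]: "\<tau>' = \<tau>" using assms(3) by (simp add: fset_inject)
    obtain p where "colour x = skip p j" "colour x' = skip p j'"
      using x by (simp add: colour_def Let_def)
    then show ?thesis using assms(4) skip_inj x by auto
  qed (use assms base in \<open>auto simp: is_new_def colour_def\<close>)
qed

text \<open>Every colour occurs around every facet, which is what later lets each block through the
  image of a facet be lifted to a cell.\<close>

lemma new_over_facet:
  assumes "facet t" "c < k"
  obtains x where "is_new x" "colour x = c" "t \<subseteq> cell x" "x \<in> t \<or> par x = t"
proof -
  obtain \<tau> where \<tau>: "fset \<tau> = t" using facet_finite[OF assms(1)] by (metis fset_to_fset)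
  have new: "is_new (New \<tau> j)" if "j < k - 1" for j
  proof -
    obtain x where "is_new x" "t \<subseteq> cell x" using assms(1) by (auto simp: facet_def)
    then obtain F where "F \<in> arboreal_cells d k" "\<tau> |\<subseteq>| F"
      using new_imp_arboreal_cells[of x] \<tau> by (auto simp: less_eq_fset.rep_eq)
    then show ?thesis using that assms(1) \<tau> by (auto simp: is_new_def facet_def fcard.rep_eq)
  qed
  obtain y where y: "y \<in> t" "\<And>j. j < k - 1 \<Longrightarrow> colour (New \<tau> j) = skip (colour y) j"
    "\<And>z. z \<in> t \<Longrightarrow> depth z \<le> depth y"
  proof -
    have "\<tau> \<noteq> {||}" using facet_nonempty[OF assms(1)] \<tau> by auto
    from deepest_fimage[OF this, of "depth_colour d"] obtain y where y: "y \<in> fset \<tau>"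
      "deepest (depth_colour d |`| \<tau>) = depth_colour d y"
      "\<And>z. z \<in> fset \<tau> \<Longrightarrow> fst (depth_colour d z) \<le> fst (depth_colour d y)" by blast
    show thesis
      by (rule that[of y]) (use y \<tau> in \<open>auto simp: depth_def colour_def Let_def\<close>)
  qed
  consider "t = base" | "is_new y" "t \<subseteq> cell y"
    using assms(1)
  proof (cases rule: facet_cases)
    case (2 y')
    then have "y' = y" using y depth_par[of y' y] by (force simp: cell_def)
    with 2 that show ?thesis by blast
  qed (use that in blast)
  \<comment> \<open>\<open>x0\<close> gives the cell with which \<open>t\<close> first appears. Its
    colour is that of the deepest vertex; the attached cells supply all others.\<close>
  then obtain x0 where x0: "is_new x0" "colour x0 = colour y" "t \<subseteq> cell x0" "x0 \<in> t \<or> par x0 = t"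
  proof cases
    case 1
    then show ?thesis using that[of "Root d"] is_new_Root y(1) colour_base
      by (auto simp: cell_def colour_def)
  next
    case 2
    then show ?thesis using that y(1) by blast
  qed
  show thesis
  proof (cases "c = colour y")
    case True
    then show ?thesis using that x0 by metis
  next
    case False
    have "colour y < k" using colour_less x0 by metis
    then obtain j where "j < k - 1" "skip (colour y) j = c"
      using skip_surj False assms(2) by metis
    then show ?thesis using that[of "New \<tau> j"] new y(2) \<tau> by (auto simp: cell_def)
  qed
qed

section \<open>Finite shells of bounded depth\<close>

definition shell :: "nat \<Rightarrow> arb_vertex set" where
  "shell D = {z. (z \<in> base \<or> is_new z) \<and> depth z \<le> D}"

lemma shell_0: "shell 0 = base"
  using depth_base depth_new by (fastforce simp: shell_def)

lemma shell_mono: "D \<le> D' \<Longrightarrow> shell D \<subseteq> shell D'"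
  by (auto simp: shell_def)

lemma par_subset_shell:
  assumes "is_new x" "depth x \<le> Suc D"
  shows "par x \<subseteq> shell D"
proof
  fix z assume z: "z \<in> par x"
  then show "z \<in> shell D"
    using cell_vertex_cases[OF assms(1), of z] depth_par[OF assms(1) z] assms(2)
    by (auto simp: shell_def cell_def)
qed

text \<open>A vertex of the next shell is a base vertex, \<open>Root d\<close>, or determined by its
  parent face inside the previous shell together with an index below \<open>k - 1\<close>.\<close>

lemma finite_shell: "finite (shell D)"
proof (induction D)
  case 0
  then show ?case by (simp add: shell_0 base_def)
next
  case (Suc D)
  have "shell (Suc D) \<subseteq> insert (Root d) (base \<union>
      (\<lambda>(A, j). New (Abs_fset A) j) ` (Pow (shell D) \<times> {..<k - 1}))" (is "_ \<subseteq> ?B")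
  proof
    fix z assume z: "z \<in> shell (Suc D)"
    consider "z \<in> base" | "z = Root d" | \<tau> j where "z = New \<tau> j" "j < k - 1" "is_new z"
      using z by (auto simp: shell_def is_new_def)
    then show "z \<in> ?B"
    proof cases
      case (3 \<tau> j)
      then have "fset \<tau> \<subseteq> shell D" using par_subset_shell[of z D] z by (auto simp: shell_def)
      then show ?thesis using 3 by (auto intro!: image_eqI[of _ _ "(fset \<tau>, j)"] simp: fset_inverse)
    qed auto
  qed
  moreover have "finite ?B" using Suc by (auto simp: base_def)
  ultimately show ?case by (rule finite_subset)
qed

end

subsection \<open>Steiner systems and the embedding\<close>

lemma steiner_member:
  assumes "S \<in> steiner_systems n d" "A \<in> S"
  shows "A \<subseteq> {1..n}" "card A = d + 1" "finite A"
  using assms by (auto simp: steiner_systems_def intro: card_ge_0_finite)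

lemma steiner_ex1:
  assumes "S \<in> steiner_systems n d" "B \<subseteq> {1..n}" "card B = d"
  shows "\<exists>!A. A \<in> S \<and> B \<subseteq> A"
  using assms unfolding steiner_systems_def by simp

lemma steiner_unique:
  assumes "S \<in> steiner_systems n d" "A \<in> S" "B \<in> S" "t \<subseteq> A" "t \<subseteq> B" "card t = d"
  shows "A = B"
  using assms steiner_member(1)[OF assms(1,2)] unfolding steiner_systems_def by blast

lemma finite_steiner_systems: "finite (steiner_systems n d)"
  by (rule finite_subset[of _ "Pow (Pow {1..n})"]) (auto simp: steiner_systems_def)

definition completing_vertex :: "nat set set \<Rightarrow> nat set \<Rightarrow> nat" where
  "completing_vertex S t = (THE v. v \<notin> t \<and> insert v t \<in> S)"

lemma completing_vertex_eqI:
  assumes "S \<in> steiner_systems n d" "card t = d" "v \<notin> t" "insert v t \<in> S"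
  shows "completing_vertex S t = v"
  unfolding completing_vertex_def
proof (rule the_equality)
  fix w assume "w \<notin> t \<and> insert w t \<in> S"
  then have "insert w t = insert v t" by (intro steiner_unique[OF assms(1), where t = t]) (use assms in auto)
  then show "w = v" using \<open>w \<notin> t \<and> insert w t \<in> S\<close> by blast
qed (use assms in auto)

lemma completing_vertex_props:
  assumes "S \<in> steiner_systems n d" "card t = d" "t \<subseteq> {1..n}"
  shows "completing_vertex S t \<notin> t" "insert (completing_vertex S t) t \<in> S"
proof -
  obtain A where A: "A \<in> S" "t \<subseteq> A"
    using assms unfolding steiner_systems_def by blast
  have cA: "card A = d + 1" "finite A" using steiner_member[OF assms(1) A(1)] by auto
  then have "card (A - t) = 1" using A(2) assms(2) by (simp add: card_Diff_subset finite_subset)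
  then obtain v where "A - t = {v}" by (auto simp: card_1_singleton_iff)
  then have v: "v \<notin> t" "insert v t = A" using A(2) by auto
  then have "completing_vertex S t = v" using completing_vertex_eqI[OF assms(1,2), of v] A by simp
  then show "completing_vertex S t \<notin> t" "insert (completing_vertex S t) t \<in> S" using v A by auto
qed

text \<open>The block through \<open>B\<close> in the image system is the \<open>p\<close>-image of
  the block through the preimage of \<open>B\<close>.\<close>

lemma steiner_image_permutes:
  assumes "p permutes {1..n}" "S \<in> steiner_systems n d"
  shows "(`) p ` S \<in> steiner_systems n d"
proof -
  have p: "inj p" "bij p" using assms(1) permutes_inj permutes_bij by auto
  have sub: "p ` A \<subseteq> {1..n}" if "A \<subseteq> {1..n}" for A
    using that permutes_image[OF assms(1)] by blast
  have inv: "inv p ` A \<subseteq> {1..n}" if "A \<subseteq> {1..n}" for A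
    using that permutes_image[OF permutes_inv[OF assms(1)]] by blast
  have 1: "A \<subseteq> {1..n} \<and> card A = d + 1" if A: "A \<in> (`) p ` S" for A
  proof -
    obtain B where "A = p ` B" "B \<in> S" using A by blast
    then show ?thesis using steiner_member[OF assms(2), of B] sub[of B] inj_on_subset[OF p(1), of B]
      by (simp add: card_image)
  qed
  have 2: "\<exists>!A. A \<in> (`) p ` S \<and> B \<subseteq> A" if B: "B \<subseteq> {1..n}" "card B = d" for B
  proof -
    have "card (inv p ` B) = d" using p B
      by (metis bij_imp_bij_inv bij_is_inj card_image inj_on_subset subset_UNIV)
    then have ex1: "\<exists>!A. A \<in> S \<and> inv p ` B \<subseteq> A"
      by (intro steiner_ex1[OF assms(2) inv[OF B(1)]])
    have iff: "B \<subseteq> p ` A \<longleftrightarrow> inv p ` B \<subseteq> A" for A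
    proof
      assume "B \<subseteq> p ` A"
      then have "inv p ` B \<subseteq> inv p ` p ` A" by (rule image_mono)
      then show "inv p ` B \<subseteq> A" using p(1) by (simp add: image_inv_f_f)
    next
      assume "inv p ` B \<subseteq> A"
      then have "p ` inv p ` B \<subseteq> p ` A" by (rule image_mono)
      then show "B \<subseteq> p ` A" using p(2) by (simp add: image_f_inv_f bij_is_surj)
    qed
    from ex1 obtain A where A: "A \<in> S \<and> inv p ` B \<subseteq> A" "\<forall>A'. A' \<in> S \<and> inv p ` B \<subseteq> A' \<longrightarrow> A' = A"
      by (rule ex1E)
    show ?thesis
    proof (rule ex1I)
      show "p ` A \<in> (`) p ` S \<and> B \<subseteq> p ` A" using A(1) iff by simp
      fix A' assume A': "A' \<in> (`) p ` S \<and> B \<subseteq> A'"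
      then obtain A'' where "A'' \<in> S" "A' = p ` A''" by blast
      then show "A' = p ` A" using A' A(2) iff by simp
    qed
  qed
  show ?thesis
    unfolding steiner_systems_def mem_Collect_eq
  proof (intro conjI ballI allI impI)
    fix A assume "A \<in> (`) p ` S"
    then show "A \<subseteq> {1..n}" "card A = d + 1" using 1 by simp_all
  next
    fix B assume "B \<subseteq> {1..n} \<and> card B = d"
    then show "\<exists>!A. A \<in> (`) p ` S \<and> B \<subseteq> A" using 2 by simp
  qed
qed

text \<open>The map is total, whatever collisions occur. Once the image of a parent face has fewer
  than \<open>d\<close> points the completing vertex loses its meaning, so the lemmas below assume
  injectivity.\<close>

primrec embed :: "nat \<Rightarrow> (nat \<Rightarrow> nat) \<Rightarrow> (nat \<Rightarrow> nat set set) \<Rightarrow> arb_vertex \<Rightarrow> nat" where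
  "embed d e S (Root i) = (if i < d then e i else completing_vertex (S 0) (e ` {..<d}))"
| "embed d e S (New \<tau> j) =
     completing_vertex (S (snd (depth_colour d (New \<tau> j)))) (fset (embed d e S |`| \<tau>))"

locale rooted_steiner = arboreal +
  fixes n :: nat and e :: "nat \<Rightarrow> nat"
  assumes inj_e: "inj_on e {..<d}" and e_range: "e ` {..<d} \<subseteq> {1..n}"
begin

text \<open>The \<open>k\<close>-tuples of Steiner systems, with value \<open>{}\<close> outside
  \<open>{..<k}\<close> to match the default in the product distribution.\<close>

definition samples :: "(nat \<Rightarrow> nat set set) set" where
  "samples = PiE_dflt {..<k} {} (\<lambda>_. steiner_systems n d)"

abbreviation \<phi> :: "(nat \<Rightarrow> nat set set) \<Rightarrow> arb_vertex \<Rightarrow> nat" where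
  "\<phi> \<equiv> embed d e"

lemma samples_steiner: "S \<in> samples \<Longrightarrow> c < k \<Longrightarrow> S c \<in> steiner_systems n d"
  by (auto simp: samples_def PiE_dflt_def)

lemma finite_samples: "finite samples"
  unfolding samples_def by (intro finite_PiE_dflt finite_steiner_systems) auto

lemma embed_base: "\<phi> S ` base = e ` {..<d}"
  by (auto simp: base_def image_image)

lemma inj_on_embed_base: "inj_on (\<phi> S) base"
  using inj_e by (auto simp: base_def inj_on_def)

lemma embed_base_eq: "z \<in> base \<Longrightarrow> \<phi> S z = \<phi> S' z"
  by (auto simp: base_def)

lemma embed_new:
  assumes "is_new x"
  shows "\<phi> S x = completing_vertex (S (colour x)) (\<phi> S ` par x)"
proof (cases x)
  case (Root i)
  then have "i = d" using assms by (auto elim: is_newE)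
  then show ?thesis using Root embed_base by (simp add: colour_def)
next
  case (New \<tau> j)
  then show ?thesis by (simp add: colour_def del: depth_colour.simps)
qed

text \<open>The sets on which \<open>\<phi>\<close> can be computed by recursion inside the set.
  Shells alone do not suffice: the collision argument uses a shell with one extra vertex.\<close>

definition closed_vertices :: "arb_vertex set \<Rightarrow> bool" where
  "closed_vertices W \<longleftrightarrow> (\<forall>x\<in>W. x \<in> base \<or> is_new x \<and> par x \<subseteq> W)"

lemma closed_shell: "closed_vertices (shell D)"
  unfolding closed_vertices_def
proof
  fix x assume "x \<in> shell D"
  then show "x \<in> base \<or> is_new x \<and> par x \<subseteq> shell D"
    using par_subset_shell[of x D] by (auto simp: shell_def)
qed

lemma embed_new_cell:
  assumes "S \<in> samples" "is_new x" "inj_on (\<phi> S) (par x)" "\<phi> S ` par x \<subseteq> {1..n}"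
  shows "\<phi> S x \<notin> \<phi> S ` par x" "\<phi> S ` cell x \<in> S (colour x)"
proof -
  have "card (\<phi> S ` par x) = d" using assms card_par by (simp add: card_image)
  from completing_vertex_props[OF samples_steiner[OF assms(1) colour_less[OF assms(2)]] this assms(4)]
  show "\<phi> S x \<notin> \<phi> S ` par x" "\<phi> S ` cell x \<in> S (colour x)"
    by (simp_all add: embed_new[OF assms(2)] cell_def)
qed

text \<open>Induction on depth: injectivity keeps the image of a parent face at size
  \<open>d\<close>, so the next value lies in a block and hence in \<open>{1..n}\<close>.\<close>

lemma embed_range:
  assumes "S \<in> samples" "closed_vertices W" "inj_on (\<phi> S) W"
  shows "\<phi> S ` W \<subseteq> {1..n}"
proof -
  have "\<phi> S z \<in> {1..n}" if "z \<in> W" for z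
    using that
  proof (induction "depth z" arbitrary: z rule: less_induct)
    case less
    show ?case
    proof (cases "z \<in> base")
      case True
      then show ?thesis using embed_base e_range by blast
    next
      case False
      then have z: "is_new z" "par z \<subseteq> W" using less.prems assms(2) by (auto simp: closed_vertices_def)
      have "\<phi> S ` par z \<subseteq> {1..n}" using less.hyps depth_par[OF z(1)] z(2) by blast
      moreover have "inj_on (\<phi> S) (par z)" using z(2) assms(3) inj_on_subset by blast
      ultimately have "\<phi> S ` cell z \<in> S (colour z)" using embed_new_cell assms(1) z(1) by blast
      then have "\<phi> S ` cell z \<subseteq> {1..n}"
        using steiner_member(1) samples_steiner[OF assms(1) colour_less[OF z(1)]] by blast
      then show ?thesis by (auto simp: cell_def)
    qed
  qed
  then show ?thesis by blast
qed

lemma embed_cell: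
  assumes "S \<in> samples" "closed_vertices W" "inj_on (\<phi> S) W" "is_new x" "par x \<subseteq> W"
  shows "\<phi> S x \<notin> \<phi> S ` par x" "\<phi> S ` cell x \<in> S (colour x)"
  using embed_new_cell[OF assms(1,4)] embed_range[OF assms(1-3)] assms(3,5) inj_on_subset by blast+

end

subsection \<open>Counting collisions\<close>

context rooted_steiner
begin

text \<open>A cell of the colour of \<open>xm\<close> through \<open>y\<close> is not
  \<open>cell y\<close>, by \<open>colour_deepest_neq\<close>; so its newest vertex is deeper than
  \<open>y\<close> and can only be \<open>xl\<close>. Equal parents would give
  \<open>xl = xm\<close> by \<open>new_eqI\<close>, which leaves the case of two different
  parents.\<close>

lemma deepest_notin_other_cell:
  assumes S: "S \<in> samples"
    and xm: "is_new xm" "depth xm = Suc D"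
    and xl: "xl \<in> shell (Suc D)" "xl \<noteq> xm"
    and inj: "inj_on (\<phi> S) (insert xl (shell D))"
    and coll: "\<phi> S xm = \<phi> S xl"
    and y: "y \<in> par xm" "depth y = D" "\<And>z. z \<in> par xm \<Longrightarrow> depth z \<le> depth y"
    and z: "z \<in> insert xl (shell D)" "is_new z" "colour z = colour xm"
  shows "y \<notin> cell z"
proof
  assume yz: "y \<in> cell z"
  have zn: "z \<noteq> y"
    using deepest_par_new[OF xm(1) y(1,3)] z colour_deepest_neq[OF xm(1) _ y(1)] not_new_base by metis
  then have yp: "y \<in> par z" using yz by (auto simp: cell_def)
  then have "depth z > D" using depth_par[OF z(2)] y(2) by blast
  then have zl: "z = xl" "depth xl = Suc D" using z(1) xl(1) by (auto simp: shell_def)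
  have parl: "par xl \<subseteq> shell D" and parm: "par xm \<subseteq> shell D"
    using par_subset_shell xm zl z(2) by auto
  have deep: "depth w \<le> depth y" if "w \<in> par xl" for w
    using parl that y(2) by (auto simp: shell_def)
  have "par xl = par xm"
  proof (rule ccontr)
    assume neq: "par xl \<noteq> par xm"
    have sub: "par xl \<subseteq> cell y" "par xm \<subseteq> cell y" "is_new y"
      using deepest_par_new[OF xm(1) y(1,3)] deepest_par_new[of xl y] z(2) zl(1) yp deep neq not_new_base
      by auto
    have cl: "card (par xl) = d" "card (par xm) = d" using card_par z(2) zl(1) xm(1) by auto
    \<comment> \<open>Both parents are \<open>d\<close>-subsets of the \<open>(d + 1)\<close>-set
      \<open>cell y\<close>. The \<open>d - 1\<close> shared vertices and the common value at
      \<open>xl\<close> and \<open>xm\<close> give \<open>d\<close> points lying in two blocks of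
      one system. So the blocks agree, and cancelling the common value contradicts
      injectivity.\<close>
    have "card (par xl \<inter> par xm) \<ge> d - 1"
    proof -
      have "card (par xl \<union> par xm) \<le> d + 1"
        using card_mono[of "cell y" "par xl \<union> par xm"] sub card_cell[OF sub(3)] by auto
      then show ?thesis using card_Un_Int[of "par xl" "par xm"] cl by simp
    qed
    then obtain t where t: "t \<subseteq> par xl \<inter> par xm" "card t = d - 1"
      by (metis obtain_subset_with_card_n)
    have pl: "\<phi> S xl \<notin> \<phi> S ` par xl" "\<phi> S ` cell xl \<in> S (colour xl)"
      using embed_cell[OF S closed_shell inj_on_subset[OF inj subset_insertI] _ parl] z(2) zl(1) by auto
    have pm: "\<phi> S xm \<notin> \<phi> S ` par xm" "\<phi> S ` cell xm \<in> S (colour xm)"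
      using embed_cell[OF S closed_shell inj_on_subset[OF inj subset_insertI] xm(1) parm] by auto
    let ?u = "insert (\<phi> S xl) (\<phi> S ` t)"
    have fin: "finite t" using t(1) finite_subset[OF _ finite_par[of xl]] by blast
    have "inj_on (\<phi> S) t" using t(1) parl inj by (meson inj_on_subset subset_insertI le_infE subset_trans)
    then have "card ?u = d"
      using fin t pl(1) d_pos by (subst card_insert_disjoint) (auto simp: card_image)
    moreover have "?u \<subseteq> \<phi> S ` cell xl" "?u \<subseteq> \<phi> S ` cell xm"
      using t(1) coll by (auto simp: cell_def)
    ultimately have "\<phi> S ` cell xl = \<phi> S ` cell xm"
      using steiner_unique[OF samples_steiner[OF S colour_less[OF xm(1)]]] pl pm z(3) zl(1) by metis
    then have "\<phi> S ` par xl = \<phi> S ` par xm"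
      using pl(1) pm(1) coll by (simp add: cell_def insert_ident)
    then show False
      using neq inj_on_image_eq_iff[OF inj, of "par xl" "par xm"] parl parm by auto
  qed
  then show False using new_eqI[of xl xm] z zl(1) xm(1) xl(2) by auto
qed

section \<open>Swapping two points in one Steiner system\<close>

definition swap_at :: "nat \<Rightarrow> nat \<Rightarrow> nat \<Rightarrow> (nat \<Rightarrow> nat set set) \<Rightarrow> nat \<Rightarrow> nat set set" where
  "swap_at c u b S = S(c := (`) (Transposition.transpose u b) ` S c)"

lemma swap_at_samples:
  assumes "S \<in> samples" "c < k" "u \<in> {1..n}" "b \<in> {1..n}"
  shows "swap_at c u b S \<in> samples"
proof -
  have "(`) (Transposition.transpose u b) ` S c \<in> steiner_systems n d"
    by (intro steiner_image_permutes permutes_swap_id samples_steiner assms)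
  then show ?thesis using assms by (auto simp: samples_def PiE_dflt_def swap_at_def)
qed

lemma swap_at_swap_at [simp]: "swap_at c u b (swap_at c u b S) = S"
  by (auto simp: swap_at_def image_image image_comp fun_eq_iff)

lemma transpose_image_id: "u \<notin> A \<Longrightarrow> b \<notin> A \<Longrightarrow> Transposition.transpose u b ` A = A"
  by (auto simp: Transposition.transpose_def image_iff)

lemma embed_swap_at:
  assumes S: "S \<in> samples" and c: "c < k" and u: "u \<in> {1..n}" and b: "b \<in> {1..n} - \<phi> S ` W"
    and W: "closed_vertices W" "inj_on (\<phi> S) W"
    and avoid: "\<And>z. z \<in> W \<Longrightarrow> is_new z \<Longrightarrow> colour z = c \<Longrightarrow> u \<notin> \<phi> S ` cell z"
  shows "z \<in> W \<Longrightarrow> \<phi> (swap_at c u b S) z = \<phi> S z"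
proof (induction "depth z" arbitrary: z rule: less_induct)
  case less
  show ?case
  proof (cases "z \<in> base")
    case True
    then show ?thesis by (rule embed_base_eq)
  next
    case False
    then have z: "is_new z" "par z \<subseteq> W" using less.prems W(1) by (auto simp: closed_vertices_def)
    have S': "swap_at c u b S \<in> samples" using swap_at_samples S c u b by blast
    have img: "\<phi> (swap_at c u b S) ` par z = \<phi> S ` par z"
      using less.hyps depth_par[OF z(1)] z(2) by (intro image_cong) auto
    have cell: "\<phi> S z \<notin> \<phi> S ` par z" "\<phi> S ` cell z \<in> S (colour z)"
      using embed_cell[OF S W z] by auto
    have "\<phi> S ` cell z \<in> swap_at c u b S (colour z)"
    proof (cases "colour z = c")
      case True
      have "b \<notin> \<phi> S ` cell z" using b z(2) less.prems by (auto simp: cell_def)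
      then have "Transposition.transpose u b ` (\<phi> S ` cell z) = \<phi> S ` cell z"
        using avoid[OF less.prems z(1) True] by (intro transpose_image_id)
      then have "\<phi> S ` cell z \<in> (`) (Transposition.transpose u b) ` S (colour z)"
        using cell(2) by (metis imageI)
      then show ?thesis using True by (simp add: swap_at_def)
    qed (use cell in \<open>simp add: swap_at_def\<close>)
    moreover have "card (\<phi> S ` par z) = d"
      using z card_par inj_on_subset[OF W(2)] by (simp add: card_image)
    ultimately have "completing_vertex (swap_at c u b S (colour z)) (\<phi> S ` par z) = \<phi> S z"
      using cell(1) samples_steiner[OF S' colour_less[OF z(1)]]
      by (intro completing_vertex_eqI) (auto simp: cell_def)
    then show ?thesis by (simp add: embed_new[OF z(1)] img)
  qed
qed

text \<open>Double counting: \<open>P\<close> pairs each bad tuple with the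
  \<open>n - card W\<close> points outside the image of \<open>W\<close>, and the swap
  \<open>h\<close> maps \<open>P\<close> injectively into \<open>samples\<close>.\<close>

lemma collision_bound:
  assumes xm: "is_new xm" "depth xm = Suc D"
    and xl: "xl \<in> shell (Suc D)" "xl \<noteq> xm"
  defines "W \<equiv> insert xl (shell D)"
  defines "B \<equiv> {S \<in> samples. inj_on (\<phi> S) W \<and> \<phi> S xm = \<phi> S xl}"
  shows "card B * (n - card W) \<le> card samples"
proof -
  obtain y where y: "y \<in> par xm" "depth y = D" "\<And>z. z \<in> par xm \<Longrightarrow> depth z \<le> depth y"
    using deepest_par[OF xm(1)] xm(2) by auto
  define c where "c = colour xm"
  have c: "c < k" using colour_less xm(1) by (simp add: c_def)
  have finW: "finite W" using finite_shell by (simp add: W_def)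
  have closedW: "closed_vertices W"
    using closed_shell par_subset_shell[of xl D] xl(1) unfolding W_def closed_vertices_def shell_def by auto
  have parm: "par xm \<subseteq> W" using par_subset_shell[of xm D] xm by (auto simp: W_def)
  have yW: "y \<in> W" using parm y(1) by blast
  have xlW: "xl \<in> W" by (simp add: W_def)
  have rng: "\<phi> S ` W \<subseteq> {1..n}" if "S \<in> B" for S
    using embed_range that closedW by (auto simp: B_def)
  define P where "P = (SIGMA S:B. {1..n} - \<phi> S ` W)"
  define h where "h = (\<lambda>(S, b). swap_at c (\<phi> S y) b S)"
  have same: "\<phi> (h (S, b)) z = \<phi> S z" if "(S, b) \<in> P" "z \<in> W" for S b z
  proof -
    have S: "S \<in> B" "S \<in> samples" "inj_on (\<phi> S) W" "\<phi> S xm = \<phi> S xl" and b: "b \<in> {1..n} - \<phi> S ` W"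
      using that by (auto simp: P_def B_def)
    have "\<phi> S y \<notin> \<phi> S ` cell x" if x: "x \<in> W" "is_new x" "colour x = c" for x
    proof -
      have "y \<notin> cell x"
        using deepest_notin_other_cell[OF S(2) xm xl _ S(4) y] S(3) x by (simp add: W_def c_def)
      moreover have "cell x \<subseteq> W" using closedW x not_new_base by (auto simp: closed_vertices_def cell_def)
      ultimately show ?thesis using S(3) yW by (meson inj_on_image_mem_iff)
    qed
    then show ?thesis
      unfolding h_def prod.case
      using rng[OF S(1)] yW b that(2) S c closedW by (intro embed_swap_at[where W = W]) auto
  qed
  have "inj_on h P"
  proof (rule inj_onI, clarify)
    fix S1 b1 S2 b2 assume P: "(S1, b1) \<in> P" "(S2, b2) \<in> P" and eq: "h (S1, b1) = h (S2, b2)"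
    \<comment> \<open>Since \<open>\<phi>\<close> is unchanged on \<open>W\<close>, both
      \<open>u\<close> and \<open>t\<close> can be read off from \<open>S'\<close> alone. Then
      \<open>b\<close> is the vertex completing \<open>t\<close> in \<open>S' c\<close>, and undoing
      the swap returns \<open>S\<close>.\<close>
    define S' where "S' = h (S1, b1)"
    define u where "u = \<phi> S' y"
    define t where "t = insert (\<phi> S' xl) (\<phi> S' ` par xm - {u})"
    have main: "b \<notin> t \<and> insert b t \<in> S' c \<and> card t = d \<and> t \<subseteq> {1..n} \<and> S = swap_at c u b S' \<and> S' \<in> samples"
      if P: "(S, b) \<in> P" "h (S, b) = S'" for S b
    proof -
      have S: "S \<in> B" "S \<in> samples" "inj_on (\<phi> S) W" "\<phi> S xm = \<phi> S xl"
        and b: "b \<in> {1..n}" "b \<notin> \<phi> S ` W"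
        using P by (auto simp: P_def B_def)
      have sm: "\<phi> S' z = \<phi> S z" if "z \<in> W" for z using same P that by metis
      have u: "u = \<phi> S y" using sm yW by (simp add: u_def)
      have t: "t = insert (\<phi> S xl) (\<phi> S ` par xm - {u})"
      proof -
        have "\<phi> S' ` par xm = \<phi> S ` par xm" using sm parm by (intro image_cong) auto
        then show ?thesis using sm[OF xlW] by (simp add: t_def)
      qed
      have S': "S' = swap_at c u b S" using P(2) u by (simp add: h_def)
      have cell: "\<phi> S xm \<notin> \<phi> S ` par xm" "\<phi> S ` cell xm \<in> S c"
        using embed_cell[OF S(2) closedW S(3) xm(1) parm] by (auto simp: c_def)
      have uin: "u \<in> \<phi> S ` par xm" using u y(1) by blast
      have bt: "b \<notin> t" using t b(2) parm xlW by auto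
      \<comment> \<open>The collision puts the value at \<open>xl\<close> outside the image of
        \<open>par xm\<close>; so exchanging \<open>u\<close> for it also keeps the size
        \<open>d\<close>.\<close>
      have ul: "u \<noteq> \<phi> S xl" using cell(1) S(4) uin by metis
      then have ut: "u \<notin> t" using t by simp
      \<comment> \<open>\<open>insert u t\<close> is the block of \<open>cell xm\<close> before the
        swap, and the swap turns it into \<open>insert b t\<close>.\<close>
      have "insert u t = insert (\<phi> S xl) (insert u (\<phi> S ` par xm))"
        using t by blast
      then have "insert u t = \<phi> S ` cell xm" using S(4) uin by (simp add: cell_def insert_absorb)
      then have "Transposition.transpose u b ` (insert u t) \<in> S' c" using cell(2) S' by (auto simp: swap_at_def)
      moreover have "Transposition.transpose u b ` (insert u t) = insert b t"
        using transpose_image_id[OF ut bt] by simp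
      moreover have "card (\<phi> S ` par xm) = d"
        using card_par[OF xm(1)] inj_on_subset[OF S(3) parm] by (simp add: card_image)
      then have "card t = d" unfolding t
        using uin cell(1) S(4) d_pos by (subst card_insert_disjoint) auto
      moreover have "t \<subseteq> {1..n}" using t rng[OF S(1)] parm xlW by auto
      moreover have "u \<in> {1..n}" using u rng[OF S(1)] yW by auto
      then have "S' \<in> samples" using S' swap_at_samples S(2) c b(1) by blast
      ultimately show ?thesis using S' bt by simp
    qed
    have m1: "b1 \<notin> t \<and> insert b1 t \<in> S' c \<and> card t = d \<and> t \<subseteq> {1..n} \<and> S1 = swap_at c u b1 S' \<and> S' \<in> samples"
      using main[OF P(1)] S'_def by simp
    have m2: "b2 \<notin> t \<and> insert b2 t \<in> S' c \<and> card t = d \<and> t \<subseteq> {1..n} \<and> S2 = swap_at c u b2 S' \<and> S' \<in> samples"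
      using main[OF P(2)] S'_def eq by simp
    have st: "S' c \<in> steiner_systems n d" using samples_steiner m1 c by blast
    have "b1 = b2" using completing_vertex_eqI[OF st, of t b1] completing_vertex_eqI[OF st, of t b2] m1 m2 by simp
    then show "S1 = S2 \<and> b1 = b2" using m1 m2 by simp
  qed
  moreover have "h ` P \<subseteq> samples"
  proof clarify
    fix S b assume "(S, b) \<in> P"
    then have "S \<in> B" "b \<in> {1..n}" by (auto simp: P_def)
    then show "h (S, b) \<in> samples"
      using rng[of S] yW c by (auto simp: h_def B_def intro!: swap_at_samples)
  qed
  ultimately have "card P \<le> card samples" using finite_samples by (metis card_inj_on_le)
  moreover have "finite B" using finite_samples by (auto simp: B_def)
  then have "card P = (\<Sum>S\<in>B. card ({1..n} - \<phi> S ` W))" by (simp add: P_def)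
  moreover have "card ({1..n} - \<phi> S ` W) = n - card W" if "S \<in> B" for S
    using rng[OF that] that finW by (subst card_Diff_subset) (auto simp: B_def card_image)
  ultimately show ?thesis by simp
qed

text \<open>Union bound over ordered pairs of vertices of the shell: the first level at which
  injectivity fails exhibits a collision covered by \<open>collision_bound\<close>.\<close>

lemma not_injective_bound:
  "card {S \<in> samples. \<not> inj_on (\<phi> S) (shell R)} * (n - card (shell R))
     \<le> (card (shell R))\<^sup>2 * card samples"
proof -
  define Q where "Q = {(x, z). x \<in> shell R \<and> z \<in> shell R \<and> is_new x \<and> z \<noteq> x \<and> depth z \<le> depth x}"
  \<comment> \<open>New vertices have positive depth, so the subtraction is exact: the levels before
    that of \<open>x\<close>, enlarged by \<open>z\<close>, are still free of collisions.\<close>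
  define B where "B = (\<lambda>(x, z). {S \<in> samples.
     inj_on (\<phi> S) (insert z (shell (depth x - 1))) \<and> \<phi> S x = \<phi> S z})"
  have "finite (shell R \<times> shell R)" by (simp add: finite_shell)
  moreover have Qsub: "Q \<subseteq> shell R \<times> shell R" by (auto simp: Q_def)
  ultimately have finQ: "finite Q" and cardQ: "card Q \<le> (card (shell R))\<^sup>2"
    using finite_subset card_mono[OF _ Qsub] by (auto simp: card_cartesian_product power2_eq_square)
  have sub: "{S \<in> samples. \<not> inj_on (\<phi> S) (shell R)} \<subseteq> (\<Union>q\<in>Q. B q)"
  proof clarify
    fix S assume S: "S \<in> samples" "\<not> inj_on (\<phi> S) (shell R)"
    define D where "D = (LEAST D. \<not> inj_on (\<phi> S) (shell D))"
    have D: "\<not> inj_on (\<phi> S) (shell D)" "D \<le> R"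
      unfolding D_def
      using LeastI[of "\<lambda>D. \<not> inj_on (\<phi> S) (shell D)" R] Least_le[of "\<lambda>D. \<not> inj_on (\<phi> S) (shell D)" R] S(2)
      by blast+
    \<comment> \<open>Level 0 is the base, mapped injectively by \<open>e\<close>, so the first bad
      level is a successor.\<close>
    then obtain E where E: "D = Suc E" using inj_on_embed_base shell_0 by (cases D) auto
    then have injE: "inj_on (\<phi> S) (shell E)" using not_less_Least[of E "\<lambda>D. \<not> inj_on (\<phi> S) (shell D)"] D_def by auto
    have top: "is_new x \<and> depth x = D" if "x \<in> shell D" "x \<notin> shell E" for x
      using that E depth_base by (fastforce simp: shell_def)
    have "\<exists>x z. x \<in> shell D \<and> x \<notin> shell E \<and> z \<in> shell D \<and> z \<noteq> x \<and> \<phi> S x = \<phi> S z \<and>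
      inj_on (\<phi> S) (insert z (shell E))"
    \<comment> \<open>Either a vertex of the new level meets the earlier shell, or the whole level
      avoids its image and two vertices of the level meet each other. In both cases \<open>z\<close>
      joins the earlier shell without loss of injectivity.\<close>
    proof (cases "\<exists>x z. x \<in> shell D \<and> x \<notin> shell E \<and> z \<in> shell E \<and> \<phi> S x = \<phi> S z")
      case True
      then obtain x z where "x \<in> shell D" "x \<notin> shell E" "z \<in> shell E" "\<phi> S x = \<phi> S z" by blast
      moreover have "z \<in> shell D" using \<open>z \<in> shell E\<close> shell_mono[of E D] E by auto
      moreover have "inj_on (\<phi> S) (insert z (shell E))" using injE \<open>z \<in> shell E\<close> by (simp add: insert_absorb)
      ultimately show ?thesis by blast
    next
      case False
      obtain x z where xz: "x \<in> shell D" "z \<in> shell D" "x \<noteq> z" "\<phi> S x = \<phi> S z"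
        using D(1) by (auto simp: inj_on_def)
      then have "x \<notin> shell E" "z \<notin> shell E" using False injE by (metis inj_onD)+
      moreover have "\<phi> S z \<notin> \<phi> S ` shell E"
      proof
        assume "\<phi> S z \<in> \<phi> S ` shell E"
        then obtain w where "w \<in> shell E" "\<phi> S z = \<phi> S w" by blast
        then show False using False xz(2) \<open>z \<notin> shell E\<close> by blast
      qed
      then have "inj_on (\<phi> S) (insert z (shell E))" using injE \<open>z \<notin> shell E\<close> by simp
      ultimately show ?thesis using xz by blast
    qed
    then obtain x z where xz: "x \<in> shell D" "x \<notin> shell E" "z \<in> shell D" "z \<noteq> x" "\<phi> S x = \<phi> S z"
      "inj_on (\<phi> S) (insert z (shell E))" by blast
    have x: "is_new x" "depth x = D" using top[OF xz(1,2)] by auto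
    have "x \<in> shell R" "z \<in> shell R" using xz(1,3) shell_mono[OF D(2)] by auto
    moreover have "depth z \<le> depth x" using xz(3) x(2) by (simp add: shell_def)
    ultimately have "(x, z) \<in> Q" using x(1) xz(4) by (simp add: Q_def)
    moreover have "S \<in> B (x, z)" using xz(5,6) x(2) S(1) E by (simp add: B_def)
    ultimately show "S \<in> (\<Union>q\<in>Q. B q)" by blast
  qed
  have each: "card (B q) * (n - card (shell R)) \<le> card samples" if "q \<in> Q" for q
  proof -
    obtain x z where q: "q = (x, z)" by force
    then have xz: "x \<in> shell R" "z \<in> shell R" "is_new x" "z \<noteq> x" "depth z \<le> depth x"
      using that by (auto simp: Q_def)
    obtain D where D: "depth x = Suc D" using depth_new[OF xz(3)] gr0_conv_Suc by auto
    have "D \<le> R" using xz(1) D by (auto simp: shell_def)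
    then have "insert z (shell D) \<subseteq> shell R" using xz(2) shell_mono by blast
    then have "card (insert z (shell D)) \<le> card (shell R)" by (intro card_mono finite_shell)
    moreover have "z \<in> shell (Suc D)" using xz D by (auto simp: shell_def)
    then have "card (B q) * (n - card (insert z (shell D))) \<le> card samples"
      using collision_bound[OF xz(3) D _ xz(4)] q D by (simp add: B_def del: inj_on_insert)
    ultimately show ?thesis by (meson diff_le_mono2 mult_le_mono2 order_trans)
  qed
  have "card {S \<in> samples. \<not> inj_on (\<phi> S) (shell R)} \<le> card (\<Union>q\<in>Q. B q)"
    using sub finQ finite_samples by (intro card_mono finite_UN_I) (auto simp: B_def)
  also have "\<dots> \<le> (\<Sum>q\<in>Q. card (B q))" by (rule card_UN_le[OF finQ])
  finally have "card {S \<in> samples. \<not> inj_on (\<phi> S) (shell R)} * (n - card (shell R))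
      \<le> (\<Sum>q\<in>Q. card (B q) * (n - card (shell R)))"
    by (simp add: sum_distrib_right[symmetric])
  also have "\<dots> \<le> card Q * card samples" using sum_bounded_above[of Q _ "card samples"] each by simp
  also have "\<dots> \<le> (card (shell R))\<^sup>2 * card samples" using cardQ by simp
  finally show ?thesis .
qed

end

subsection \<open>Neighbourhoods without collisions\<close>

lemma simplicial_iso_sym:
  assumes "simplicial_iso X Y"
  shows "simplicial_iso Y X"
proof -
  obtain f where f: "bij_betw f (\<Union>X) (\<Union>Y)" "(\<lambda>s. f ` s) ` X = Y"
    using assms by (auto simp: simplicial_iso_def)
  let ?g = "inv_into (\<Union>X) f"
  have "bij_betw ?g (\<Union>Y) (\<Union>X)" using f(1) by (rule bij_betw_inv_into)
  moreover have "?g ` f ` s = s" if "s \<in> X" for s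
    using that f(1) by (intro inv_into_image_cancel) (auto simp: bij_betw_def)
  then have "(\<lambda>s. ?g ` s) ` Y = X"
    unfolding f(2)[symmetric] image_image by simp
  ultimately show ?thesis by (auto simp: simplicial_iso_def)
qed

context arboreal
begin

abbreviation \<T> :: "arb_vertex set set" where
  "\<T> \<equiv> arboreal_complex d k"

lemma faces_arboreal_facet: "t \<in> faces (int d - 1) \<T> \<longleftrightarrow> facet t"
proof -
  have "facet t \<Longrightarrow> finite t" by (rule facet_finite)
  then show ?thesis by (auto simp: faces_def arboreal_complex_iff facet_def)
qed

lemma faces_arboreal_cell: "t \<in> faces (int d) \<T> \<longleftrightarrow> (\<exists>x. is_new x \<and> t = cell x)"
proof
  assume "t \<in> faces (int d) \<T>"
  then obtain x where "is_new x" "t \<subseteq> cell x" "card t = d + 1"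
    by (auto simp: faces_def arboreal_complex_iff)
  then show "\<exists>x. is_new x \<and> t = cell x" using card_cell[of x] card_subset_eq[of "cell x" t] by auto
qed (use card_cell in \<open>auto simp: faces_def arboreal_complex_iff\<close>)

text \<open>If the newest vertex is not in \<open>t\<close>, then \<open>t\<close> is the whole
  parent face. It then contains the deepest parent, exactly one level above
  \<open>x\<close>.\<close>

lemma cell_subset_shell:
  assumes "facet t" "t \<subseteq> shell m" "is_new x" "t \<subseteq> cell x"
  shows "cell x \<subseteq> shell (Suc m)"
proof -
  have "depth x \<le> Suc m"
  proof (cases "x \<in> t")
    case True
    then show ?thesis using assms(2) by (auto simp: shell_def)
  next
    case False
    then have "t \<subseteq> par x" using assms(4) by (auto simp: cell_def)
    then have "t = par x" using assms(1) card_par[OF assms(3)]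
      by (intro card_subset_eq) (auto simp: facet_def)
    moreover obtain y where "y \<in> par x" "depth x = Suc (depth y)" using deepest_par[OF assms(3)] by blast
    ultimately show ?thesis using assms(2) by (auto simp: shell_def)
  qed
  moreover from this have "par x \<subseteq> shell m" by (intro par_subset_shell assms)
  ultimately show ?thesis using assms(3) shell_mono[of m "Suc m"] by (auto simp: cell_def shell_def)
qed

end

text \<open>Injectivity is required one level beyond the radius: the facets in the ball lie in
  \<open>shell r\<close>, but the cells around them reach depth \<open>r + 1\<close>.\<close>

locale embedded_steiner = rooted_steiner +
  fixes S :: "nat \<Rightarrow> nat set set" and r :: nat
  assumes S: "S \<in> samples" and inj: "inj_on (\<phi> S) (shell (Suc r))"
begin

abbreviation f :: "arb_vertex \<Rightarrow> nat" where "f \<equiv> \<phi> S"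
abbreviation X :: "nat set set" where "X \<equiv> steiner_complex d k n S"
abbreviation root_face :: "nat set" where "root_face \<equiv> e ` {..<d}"

lemma range_shell: "t \<subseteq> shell (Suc r) \<Longrightarrow> f ` t \<subseteq> {1..n}"
  using embed_range[OF S closed_shell inj] by blast

lemma inj_sub: "t \<subseteq> shell (Suc r) \<Longrightarrow> inj_on f t"
  using inj inj_on_subset by blast

lemma card_f: "t \<subseteq> shell (Suc r) \<Longrightarrow> card (f ` t) = card t"
  by (intro card_image inj_sub)

lemma f_image_eq: "s \<subseteq> shell (Suc r) \<Longrightarrow> t \<subseteq> shell (Suc r) \<Longrightarrow> f ` s = f ` t \<longleftrightarrow> s = t"
  using inj_on_image_eq_iff[OF inj] by blast

lemma preimage_subset:
  assumes "u \<subseteq> shell (Suc r)" "\<rho> \<subseteq> f ` u"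
  obtains s where "s \<subseteq> u" "f ` s = \<rho>" "card s = card \<rho>"
proof -
  obtain s where "s \<subseteq> u" "f ` s = \<rho>" using assms(2) by (metis subset_imageE)
  then show thesis using that card_f assms(1) by (metis subset_trans)
qed

lemma member_X: "s \<in> X \<longleftrightarrow> s \<subseteq> {1..n} \<and> card s \<le> d \<or> (\<exists>c<k. s \<in> S c)"
  by (auto simp: steiner_complex_def)

lemma card_S: "c < k \<Longrightarrow> A \<in> S c \<Longrightarrow> card A = d + 1 \<and> finite A"
  using steiner_member[OF samples_steiner[OF S]] by simp

lemma faces_X_facet: "\<rho> \<in> faces (int d - 1) X \<longleftrightarrow> \<rho> \<subseteq> {1..n} \<and> card \<rho> = d"
proof
  assume "\<rho> \<in> faces (int d - 1) X"
  then have "\<rho> \<in> X" "card \<rho> = d" by (auto simp: faces_def)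
  then show "\<rho> \<subseteq> {1..n} \<and> card \<rho> = d" using card_S by (metis member_X Suc_eq_plus1 n_not_Suc_n)
next
  assume "\<rho> \<subseteq> {1..n} \<and> card \<rho> = d"
  then show "\<rho> \<in> faces (int d - 1) X"
    using finite_subset[of \<rho> "{1..n}"] by (simp add: faces_def member_X)
qed

lemma faces_X_cell: "F \<in> faces (int d) X \<longleftrightarrow> (\<exists>c<k. F \<in> S c)"
proof
  assume "F \<in> faces (int d) X"
  then have "F \<in> X" "card F = d + 1" by (auto simp: faces_def)
  then show "\<exists>c<k. F \<in> S c" by (simp add: member_X)
next
  assume "\<exists>c<k. F \<in> S c"
  then show "F \<in> faces (int d) X" using card_S[of _ F] by (auto simp: faces_def member_X)
qed

lemma embed_cell_in:
  assumes "is_new x" "cell x \<subseteq> shell (Suc r)"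
  shows "f ` cell x \<in> S (colour x)"
  using embed_cell[OF S closed_shell inj assms(1)] assms(2) by (auto simp: cell_def)

text \<open>The cell of colour \<open>c\<close> over \<open>t\<close> maps to a block of
  \<open>S c\<close> through the image of \<open>t\<close>, and a Steiner system has only one such
  block. This makes the embedding locally surjective.\<close>

lemma cells_over_facet:
  assumes t: "facet t" "t \<subseteq> shell m" "m \<le> r" and F: "c < k" "F \<in> S c" "f ` t \<subseteq> F"
  obtains x where "is_new x" "t \<subseteq> cell x" "cell x \<subseteq> shell (Suc r)" "F = f ` cell x"
proof -
  obtain x where x: "is_new x" "colour x = c" "t \<subseteq> cell x"
    using new_over_facet[OF t(1) F(1)] by metis
  have sub: "cell x \<subseteq> shell (Suc r)"
    using cell_subset_shell[OF t(1,2) x(1,3)] shell_mono[of "Suc m" "Suc r"] t(3) by auto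
  then have "f ` cell x \<in> S c" using embed_cell_in x by auto
  moreover have "card (f ` t) = d" using card_f[of t] x(3) sub t(1) by (auto simp: facet_def)
  ultimately have "F = f ` cell x"
    using steiner_unique[OF samples_steiner[OF S F(1)] F(2) _ F(3)] x(3) by blast
  then show thesis using that x sub by blast
qed

text \<open>The depth bound is carried through the induction because \<open>f\<close> is known to be
  injective only up to depth \<open>r + 1\<close>.\<close>

lemma path_image:
  assumes "(base, t) \<in> face_graph d \<T> ^^ m" "m \<le> r"
  shows "facet t \<and> t \<subseteq> shell m \<and> (root_face, f ` t) \<in> face_graph d X ^^ m"
  using assms
proof (induction m arbitrary: t)
  case 0
  then show ?case using facet_base shell_0 embed_base by auto
next
  case (Suc m)
  then obtain t0 where t0: "(base, t0) \<in> face_graph d \<T> ^^ m" "(t0, t) \<in> face_graph d \<T>" by auto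
  then have IH: "facet t0" "t0 \<subseteq> shell m" "(root_face, f ` t0) \<in> face_graph d X ^^ m"
    using Suc by auto
  obtain x where x: "facet t" "t0 \<noteq> t" "is_new x" "t0 \<union> t = cell x"
    using t0(2) unfolding face_graph_def faces_arboreal_cell faces_arboreal_facet by auto
  have sub: "cell x \<subseteq> shell (Suc m)"
    using cell_subset_shell[OF IH(1,2) x(3)] x(4) by auto
  then have sub': "cell x \<subseteq> shell (Suc r)" using shell_mono[of "Suc m" "Suc r"] Suc.prems by auto
  have tr: "t \<subseteq> shell (Suc r)" "t0 \<subseteq> shell (Suc r)" using sub' x(4) by auto
  have "f ` t0 \<union> f ` t = f ` cell x" using x(4) by blast
  moreover have "f ` cell x \<in> S (colour x)" "colour x < k"
    using embed_cell_in x(3) sub' colour_less by auto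
  moreover have "f ` t0 \<noteq> f ` t" using f_image_eq tr x(2) by blast
  ultimately have "(f ` t0, f ` t) \<in> face_graph d X"
    using range_shell tr card_f x(1) IH(1)
    unfolding face_graph_def faces_X_facet faces_X_cell by (auto simp: facet_def)
  then have "(root_face, f ` t) \<in> face_graph d X ^^ Suc m" using IH(3) by auto
  then show ?case using x(1,4) sub by blast
qed

text \<open>Each step in \<open>X\<close> uses a block containing a face already lifted.
  \<open>cells_over_facet\<close> lifts the block, and the next face is pulled back inside the
  resulting cell.\<close>

lemma path_lift:
  assumes "(root_face, \<rho>) \<in> face_graph d X ^^ m" "m \<le> r"
  shows "\<exists>t. (base, t) \<in> face_graph d \<T> ^^ m \<and> \<rho> = f ` t"
  using assms
proof (induction m arbitrary: \<rho>)
  case 0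
  then show ?case using embed_base by auto
next
  case (Suc m)
  then obtain \<rho>0 where \<rho>0: "(root_face, \<rho>0) \<in> face_graph d X ^^ m" "(\<rho>0, \<rho>) \<in> face_graph d X" by auto
  obtain t0 where t0: "(base, t0) \<in> face_graph d \<T> ^^ m" "\<rho>0 = f ` t0"
    using Suc.IH[OF \<rho>0(1)] Suc.prems(2) by auto
  have t0': "facet t0" "t0 \<subseteq> shell m" using path_image t0(1) Suc.prems(2) by auto
  obtain c where c: "card \<rho> = d" "f ` t0 \<noteq> \<rho>" "c < k" "f ` t0 \<union> \<rho> \<in> S c"
    using \<rho>0(2) t0(2) unfolding face_graph_def faces_X_facet faces_X_cell by auto
  obtain x where x: "is_new x" "t0 \<subseteq> cell x" "cell x \<subseteq> shell (Suc r)" "f ` t0 \<union> \<rho> = f ` cell x"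
    using cells_over_facet[OF t0' _ c(3,4)] Suc.prems(2) by auto
  obtain t where t: "t \<subseteq> cell x" "f ` t = \<rho>" "card t = card \<rho>"
    using preimage_subset[OF x(3), of \<rho>] x(4) by blast
  have "f ` (t0 \<union> t) = f ` cell x" using x(4) t(2) by blast
  then have "t0 \<union> t = cell x" using f_image_eq[of "t0 \<union> t" "cell x"] x(2,3) t(1) by blast
  moreover have "facet t" using t(1,3) c(1) x(1) by (auto simp: facet_def)
  ultimately have "(t0, t) \<in> face_graph d \<T>"
    using t0'(1) x(1) c(2) t(2) unfolding face_graph_def faces_arboreal_cell faces_arboreal_facet by auto
  then show ?case using t0(1) t(2) by auto
qed

lemma arboreal_face_ball:
  assumes "t \<in> face_ball d \<T> base r"
  shows "facet t" "t \<subseteq> shell r" "t \<subseteq> shell (Suc r)"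
proof -
  obtain m where m: "m \<le> r" "(base, t) \<in> face_graph d \<T> ^^ m" using assms by (auto simp: face_ball_def)
  show "facet t" "t \<subseteq> shell r" "t \<subseteq> shell (Suc r)"
    using path_image[OF m(2,1)] shell_mono[OF m(1)] shell_mono[of r "Suc r"] by auto
qed

section \<open>Matching the faces of the two balls\<close>

lemma image_face_ball: "(`) f ` face_ball d \<T> base r = face_ball d X root_face r"
proof (intro equalityI subsetI)
  fix \<rho> assume "\<rho> \<in> (`) f ` face_ball d \<T> base r"
  then obtain t where t: "t \<in> face_ball d \<T> base r" "\<rho> = f ` t" by blast
  then obtain m where "m \<le> r" "(base, t) \<in> face_graph d \<T> ^^ m" by (auto simp: face_ball_def)
  moreover have "f ` t \<in> faces (int d - 1) X"
    using arboreal_face_ball[OF t(1)] range_shell card_f by (auto simp: faces_X_facet facet_def)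
  ultimately show "\<rho> \<in> face_ball d X root_face r"
    using path_image t(2) by (auto simp: face_ball_def)
next
  fix \<rho> assume "\<rho> \<in> face_ball d X root_face r"
  then obtain m where m: "m \<le> r" "(root_face, \<rho>) \<in> face_graph d X ^^ m" by (auto simp: face_ball_def)
  then obtain t where t: "(base, t) \<in> face_graph d \<T> ^^ m" "\<rho> = f ` t" using path_lift by blast
  then have "t \<in> face_ball d \<T> base r"
    using path_image[OF t(1) m(1)] m(1) by (auto simp: face_ball_def faces_arboreal_facet)
  then show "\<rho> \<in> (`) f ` face_ball d \<T> base r" using t(2) by blast
qed

lemma face_ball_lift:
  assumes "\<rho> \<in> face_ball d X root_face r"
  obtains t where "t \<in> face_ball d \<T> base r" "\<rho> = f ` t"
  using assms unfolding image_face_ball[symmetric] by (rule imageE) (rule that)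

text \<open>Forward, the parent face lies in the ball, which keeps the cell within depth
  \<open>r + 1\<close>. Backward, a single facet of the block is lifted to find the cell, and
  injectivity brings all facets of that cell into the ball.\<close>

lemma image_ball_cells:
  "(`) f ` {\<tau> \<in> faces (int d) \<T>. \<forall>\<rho>\<in>faces (int d - 1) \<T>. \<rho> \<subseteq> \<tau> \<longrightarrow> \<rho> \<in> face_ball d \<T> base r} =
   {\<tau> \<in> faces (int d) X. \<forall>\<rho>\<in>faces (int d - 1) X. \<rho> \<subseteq> \<tau> \<longrightarrow> \<rho> \<in> face_ball d X root_face r}"
  (is "(`) f ` ?A = ?B")
proof (intro equalityI subsetI)
  fix F assume "F \<in> (`) f ` ?A"
  then obtain x where x: "is_new x" "F = f ` cell x"
    "\<And>t. facet t \<Longrightarrow> t \<subseteq> cell x \<Longrightarrow> t \<in> face_ball d \<T> base r"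
    by (auto simp: faces_arboreal_cell faces_arboreal_facet)
  have "par x \<subseteq> cell x" by (auto simp: cell_def)
  then have sub: "cell x \<subseteq> shell (Suc r)"
    using cell_subset_shell[of "par x" r x] x(1,3) facet_par arboreal_face_ball by blast
  show "F \<in> ?B"
  proof (intro CollectI conjI ballI impI)
    show "F \<in> faces (int d) X"
      using embed_cell_in[OF x(1) sub] colour_less x(1,2) by (auto simp: faces_X_cell)
    fix \<rho> assume \<rho>: "\<rho> \<in> faces (int d - 1) X" "\<rho> \<subseteq> F"
    obtain t where t: "t \<subseteq> cell x" "f ` t = \<rho>" "card t = card \<rho>"
      using preimage_subset[OF sub, of \<rho>] \<rho>(2) x(2) by blast
    then have "facet t" using \<rho>(1) x(1) by (auto simp: facet_def faces_X_facet)
    then show "\<rho> \<in> face_ball d X root_face r" using x(3) t image_face_ball by blast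
  qed
next
  fix F assume F: "F \<in> ?B"
  then obtain c where c: "c < k" "F \<in> S c" by (auto simp: faces_X_cell)
  have all: "\<rho> \<in> face_ball d X root_face r" if "\<rho> \<subseteq> F" "card \<rho> = d" for \<rho>
    using F that steiner_member(1)[OF samples_steiner[OF S c(1)] c(2)] by (auto simp: faces_X_facet)
  have "card F = d + 1" using steiner_member(2)[OF samples_steiner[OF S c(1)] c(2)] .
  then obtain \<rho> where \<rho>: "\<rho> \<subseteq> F" "card \<rho> = d"
    by (metis le_add1 obtain_subset_with_card_n)
  then obtain t where t: "t \<in> face_ball d \<T> base r" "\<rho> = f ` t"
    using face_ball_lift[OF all[OF \<rho>]] by metis
  have "f ` t \<subseteq> F" using \<rho>(1) t(2) by simp
  then obtain x where x: "is_new x" "cell x \<subseteq> shell (Suc r)" "F = f ` cell x"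
    using cells_over_facet[OF arboreal_face_ball(1,2)[OF t(1)] order_refl c] by metis
  have "t' \<in> face_ball d \<T> base r" if t': "facet t'" "t' \<subseteq> cell x" for t'
  proof -
    have sub: "t' \<subseteq> shell (Suc r)" using t'(2) x(2) by blast
    have "f ` t' \<in> face_ball d X root_face r"
      using t' x(3) card_f[OF sub] by (intro all) (auto simp: facet_def)
    then obtain t'' where "t'' \<in> face_ball d \<T> base r" "f ` t' = f ` t''" by (rule face_ball_lift)
    then show ?thesis using f_image_eq[OF sub arboreal_face_ball(3)] by metis
  qed
  then have "cell x \<in> ?A" using x(1) by (auto simp: faces_arboreal_cell faces_arboreal_facet)
  then show "F \<in> (`) f ` ?A" using x(3) by blast
qed

text \<open>In these dimensions every subset of \<open>{1..n}\<close> of the right size is a face of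
  \<open>X\<close>, so only containment in a ball face has to be transported.\<close>

lemma image_ball_lower:
  assumes "l < int d - 1"
  shows "(`) f ` {\<rho> \<in> faces l \<T>. \<exists>\<sigma>\<in>face_ball d \<T> base r. \<rho> \<subseteq> \<sigma>} =
    {\<rho> \<in> faces l X. \<exists>\<sigma>\<in>face_ball d X root_face r. \<rho> \<subseteq> \<sigma>}" (is "(`) f ` ?A = ?B")
proof (intro equalityI subsetI)
  fix \<rho> assume "\<rho> \<in> (`) f ` ?A"
  then obtain s t where s: "s \<in> faces l \<T>" "t \<in> face_ball d \<T> base r" "s \<subseteq> t" "\<rho> = f ` s" by blast
  have sub: "s \<subseteq> shell (Suc r)" using s(2,3) arboreal_face_ball(3) by blast
  have "f ` s \<in> faces l X"
    using s(1) assms range_shell[OF sub] card_f[OF sub] by (auto simp: faces_def steiner_complex_def)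
  then show "\<rho> \<in> ?B" using s image_face_ball by blast
next
  fix \<rho> assume "\<rho> \<in> ?B"
  then obtain \<sigma> where \<sigma>: "\<rho> \<in> faces l X" "\<sigma> \<in> face_ball d X root_face r" "\<rho> \<subseteq> \<sigma>" by blast
  obtain t where "t \<in> face_ball d \<T> base r" "\<sigma> = f ` t" using \<sigma>(2) by (rule face_ball_lift)
  with \<sigma> have \<rho>: "\<rho> \<in> faces l X" "t \<in> face_ball d \<T> base r" "\<rho> \<subseteq> f ` t" by simp_all
  note t = arboreal_face_ball[OF \<rho>(2)]
  obtain s where s: "s \<subseteq> t" "f ` s = \<rho>" "card s = card \<rho>" using preimage_subset[OF t(3) \<rho>(3)] .
  have "s \<in> \<T>" using s(1) t(1) by (auto simp: arboreal_complex_iff facet_def)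
  moreover have "finite s" using s(1) facet_finite[OF t(1)] finite_subset by blast
  ultimately have "s \<in> faces l \<T>" using \<rho>(1) s(3) by (auto simp: faces_def)
  then show "\<rho> \<in> (`) f ` ?A" using s \<rho>(2) by blast
qed

lemma image_arboreal_ball: "(`) f ` arboreal_ball d k r = neighbouring_complex d X root_face r"
  unfolding arboreal_ball_def base_def[symmetric] neighbouring_complex_def image_Un image_UN
    image_face_ball image_ball_cells
  by (intro arg_cong2[where f = "(\<union>)"] refl SUP_cong) (simp add: image_ball_lower)

lemma arboreal_ball_subset_shell: "\<Union>(arboreal_ball d k r) \<subseteq> shell (Suc r)"
proof (rule Union_least)
  fix s assume "s \<in> arboreal_ball d k r"
  then consider "s \<in> face_ball d \<T> base r"
    | "s \<in> faces (int d) \<T>" "\<forall>\<rho>\<in>faces (int d - 1) \<T>. \<rho> \<subseteq> s \<longrightarrow> \<rho> \<in> face_ball d \<T> base r"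
    | t where "t \<in> face_ball d \<T> base r" "s \<subseteq> t"
    unfolding arboreal_ball_def base_def[symmetric] neighbouring_complex_def by blast
  then show "s \<subseteq> shell (Suc r)"
  proof cases
    case 2
    then obtain x where x: "is_new x" "s = cell x" by (auto simp: faces_arboreal_cell)
    have "par x \<subseteq> cell x" by (auto simp: cell_def)
    then show ?thesis
      using cell_subset_shell[of "par x" r x] x 2(2) facet_par arboreal_face_ball
      unfolding faces_arboreal_facet[symmetric] by blast
  qed (use arboreal_face_ball(3) in blast)+
qed

lemma neighbourhood_iso: "simplicial_iso (neighbouring_complex d X root_face r) (arboreal_ball d k r)"
\<comment> \<open>The isomorphism is constructed from the arboreal side, where \<open>f\<close> is
  defined.\<close>
proof (rule simplicial_iso_sym)
  have "bij_betw f (\<Union>(arboreal_ball d k r)) (\<Union>(neighbouring_complex d X root_face r))"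
    unfolding image_arboreal_ball[symmetric] bij_betw_def
    using inj_sub[OF arboreal_ball_subset_shell] by blast
  then show "simplicial_iso (arboreal_ball d k r) (neighbouring_complex d X root_face r)"
    using image_arboreal_ball by (auto simp: simplicial_iso_def)
qed

end

section \<open>The probability estimate\<close>

theorem theorem3p9:
  fixes d k :: nat
  assumes "d \<ge> 1" and "k \<ge> 1"
  shows "\<forall>r::nat. \<exists>C::real. C > 0 \<and>
    (\<forall>n::nat. admissible d n \<longrightarrow> steiner_systems n d \<noteq> {} \<longrightarrow>
      (\<forall>\<sigma>. \<sigma> \<subseteq> {1..n} \<and> card \<sigma> = d \<longrightarrow>
        measure_pmf.prob (random_steiner_complex d k n)
          {X. simplicial_iso (neighbouring_complex d X \<sigma> r) (arboreal_ball d k r)}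
        \<ge> 1 - C / real n))"
proof
  fix r :: nat
  interpret arboreal d k using assms by unfold_locales
  \<comment> \<open>\<open>M\<close> is fixed before \<open>n\<close> and \<sigma> are chosen and
    depends only on \<open>d\<close>, \<open>k\<close> and \<open>r\<close>.\<close>
  define M where "M = card (shell (Suc r))"
  \<comment> \<open>The summand \<open>2 * real M\<close> makes the bound trivial for
    \<open>n < 2 * M\<close>, the summand with the square covers the collisions for larger
    \<open>n\<close>, and \<open>1\<close> ensures positivity.\<close>
  define C where "C = 2 * real M + 2 * (real M)\<^sup>2 + 1"
  show "\<exists>C::real. C > 0 \<and>
    (\<forall>n::nat. admissible d n \<longrightarrow> steiner_systems n d \<noteq> {} \<longrightarrow>
      (\<forall>\<sigma>. \<sigma> \<subseteq> {1..n} \<and> card \<sigma> = d \<longrightarrow>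
        measure_pmf.prob (random_steiner_complex d k n)
          {X. simplicial_iso (neighbouring_complex d X \<sigma> r) (arboreal_ball d k r)}
        \<ge> 1 - C / real n))"
  proof (intro exI[of _ C] conjI allI impI)
    show "C > 0" by (simp add: C_def add_nonneg_pos)
    fix n \<sigma> assume adm: "admissible d n" and ne: "steiner_systems n d \<noteq> {}"
      and \<sigma>: "\<sigma> \<subseteq> {1..n} \<and> card \<sigma> = d"
    have npos: "n > 0" using adm by (simp add: admissible_def)
    let ?E = "{X. simplicial_iso (neighbouring_complex d X \<sigma> r) (arboreal_ball d k r)}"
    let ?P = "measure_pmf.prob (random_steiner_complex d k n) ?E"
    show "1 - C / real n \<le> ?P"
    proof (cases "n < 2 * M")
      case True
      then have "real n \<le> 2 * real M" by linarith
      also have "\<dots> \<le> C" by (simp add: C_def)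
      finally have "real n \<le> C" .
      then have "1 - C / real n \<le> 0" using npos by simp
      then show ?thesis using measure_nonneg order_trans by blast
    next
      case False
      have fin: "finite \<sigma>" using \<sigma> finite_subset by blast
      obtain e where "bij_betw e {..<d} \<sigma>"
        using ex_bij_betw_nat_finite[OF fin] \<sigma> by (auto simp: atLeast0LessThan)
      then have e: "inj_on e {..<d}" "e ` {..<d} = \<sigma>" by (auto simp: bij_betw_def)
      interpret rooted_steiner d k n e using e \<sigma> by unfold_locales auto
      let ?bad = "{S \<in> samples. \<not> inj_on (\<phi> S) (shell (Suc r))}"
      let ?U = "pmf_of_set samples"
      obtain S\<^sub>0 where "S\<^sub>0 \<in> steiner_systems n d" using ne by blast
      then have "(\<lambda>j. if j < k then S\<^sub>0 else {}) \<in> samples" by (simp add: samples_def PiE_dflt_def)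
      then have ne': "samples \<noteq> {}" by blast
      have N: "real (card samples) > 0" using ne' finite_samples by (simp add: card_gt_0_iff)
      \<comment> \<open>A product of uniform distributions is uniform on the product set, so
        probabilities become ratios of cardinalities.\<close>
      have law: "random_steiner_complex d k n = map_pmf (steiner_complex d k n) ?U"
        unfolding random_steiner_complex_def samples_def
        by (subst Pi_pmf_of_set) (use ne finite_steiner_systems in auto)
      have "real (card ?bad) * (real n - real M) \<le> (real M)\<^sup>2 * real (card samples)"
      proof -
        have "real (card ?bad * (n - M)) \<le> real (M\<^sup>2 * card samples)"
          using not_injective_bound[of "Suc r"] unfolding M_def by (rule of_nat_mono)
        then show ?thesis using False by (simp add: of_nat_diff)
      qed
      \<comment> \<open>From \<open>n \<ge> 2 * M\<close> follows \<open>n - M \<ge> n / 2\<close>,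
        the source of the factor 2 in \<open>C\<close>.\<close>
      moreover have "real (card ?bad) * (real n / 2) \<le> real (card ?bad) * (real n - real M)"
        using False by (intro mult_left_mono) auto
      ultimately have "real (card ?bad) * real n \<le> 2 * (real M)\<^sup>2 * real (card samples)" by simp
      also have "\<dots> \<le> C * real (card samples)" by (intro mult_right_mono) (simp_all add: C_def)
      finally have "real (card ?bad) / real (card samples) \<le> C / real n"
        using N npos by (simp add: field_simps)
      moreover have "measure_pmf.prob ?U ?bad = real (card ?bad) / real (card samples)"
        using measure_pmf_of_set[OF ne' finite_samples, of ?bad] by (simp add: Int_def conj_ac)
      moreover have "measure_pmf.prob ?U (samples - ?bad) = 1 - measure_pmf.prob ?U ?bad"
      proof -
        have "measure_pmf.prob ?U samples = 1"
          using measure_pmf_of_set[OF ne' finite_samples, of samples] N by simp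
        then show ?thesis by (subst measure_pmf.finite_measure_Diff) auto
      qed
      \<comment> \<open>Samples without a collision up to depth \<open>r + 1\<close> satisfy
        \<open>embedded_steiner\<close>, so the isomorphism event contains them.\<close>
      moreover have "measure_pmf.prob ?U (samples - ?bad) \<le> measure_pmf.prob ?U (steiner_complex d k n -` ?E)"
      proof (intro measure_pmf.finite_measure_mono subsetI)
        fix S assume "S \<in> samples - ?bad"
        then interpret embedded_steiner d k n e S r by unfold_locales auto
        show "S \<in> steiner_complex d k n -` ?E" using neighbourhood_iso e(2) by simp
      qed simp
      moreover have "?P = measure_pmf.prob ?U (steiner_complex d k n -` ?E)"
        unfolding law by simp
      ultimately show ?thesis by simp
    qed
  qed
qed

end
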